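(* Let $0<q\le 1$, $0\le\theta\le1$, let $k\ge1$ be an integer, and for $n\ge 0$ and $t\in\mathbb R$ let $\phi_q(t;n,k;\theta)=E_{q,\theta}\big(t^{E_{n,k}}\big)=\sum_{x}t^{x}P_{q,\theta}(E_{n,k}=x)$ be the probability generating function of $E_{n,k}$. Then for all integers $n>k+1$ and all $t\in\mathbb R$, $$\begin{aligned}\phi_q(t;n,k;\theta)=\ &\theta\,\phi_q(t;n-1,k;\theta)+(1-\theta)\Big\{\phi_q(t;n-1,k;\theta q)\\&+\theta^{k}(t-1)\phi_q(t;n-k-1,k;\theta q)+\theta^{k+1}(1-t)\phi_q(t;n-k-2,k;\theta q)\Big\},\end{aligned}$$ with $\phi_q(t;n,k;\theta)=1$ for $0\le n<k$, $\phi_q(t;k,k;\theta)=1+\theta^{k}(t-1)$, and $\phi_q(t;k+1,k;\theta)=1-\theta^{k}(1-\theta)(1+q^{k})+\theta^{k}(1-\theta)(1+q^{k})t$.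
   Context: A $q$-sequence of binary trials with parameters $(\theta,q)$ is a sequence of $\{0,1\}$-valued random variables $X_1,X_2,\dots$ ($1$ = success, $0$ = failure) such that, conditionally on $X_1,\dots,X_{j-1}$, the probability that $X_j=1$ is $\theta q^{z}$, where $z=\sum_{m=1}^{j-1}(1-X_m)$ is the number of failures among the first $j-1$ trials (so the probability that $X_j=0$ is $1-\theta q^{z}$). For $q=1$ these are i.i.d. Bernoulli trials with success probability $\theta$. $P_{q,\theta}$ and $E_{q,\theta}$ denote probability and expectation under this model. A success run of length exactly $k$ is a block of $k$ consecutive ones that is preceded by a zero or by the beginning of the sequence and followed by a zero or by the end of the sequence. $E_{n,k}$ counts the success runs of length exactly $k$ in $X_1,\dots,X_n$; $E_{0,k}=0$. Convention: $0^0=1$. *)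

theory Defs
  imports "HOL-Probability.Probability"
begin

text \<open>The trials are indexed from \<open>1\<close>; the value of \<open>X 0\<close> is irrelevant.
  Conditional probabilities are only constrained for histories of positive probability.\<close>

definition q_sequence :: "'a measure \<Rightarrow> (nat \<Rightarrow> 'a \<Rightarrow> nat) \<Rightarrow> real \<Rightarrow> real \<Rightarrow> bool" where
  "q_sequence M X \<theta> q \<longleftrightarrow>
     prob_space M \<and>
     (\<forall>j\<ge>1. X j \<in> M \<rightarrow>\<^sub>M count_space {0, 1}) \<and>
     (\<forall>j\<ge>1. \<forall>x \<in> {1..<j} \<rightarrow> {0, 1}.
        \<P>(\<omega> in M. \<forall>m\<in>{1..<j}. X m \<omega> = x m) > 0 \<longrightarrow>
        \<P>(\<omega> in M. X j \<omega> = 1 \<bar> \<forall>m\<in>{1..<j}. X m \<omega> = x m) = \<theta> * q ^ (\<Sum>m=1..<j. 1 - x m))"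

text \<open>The block starting at position \<open>i\<close> occupies the positions \<open>i, \<dots>, i + k - 1\<close>.\<close>

definition exact_runs :: "nat \<Rightarrow> nat \<Rightarrow> (nat \<Rightarrow> nat) \<Rightarrow> nat" where
  "exact_runs n k x = card {i. 1 \<le> i \<and> i + k \<le> n + 1 \<and> (\<forall>m\<in>{i..<i + k}. x m = 1) \<and>
     (i = 1 \<or> x (i - 1) = 0) \<and> (i + k = n + 1 \<or> x (i + k) = 0)}"

definition runs_pgf :: "'a measure \<Rightarrow> (nat \<Rightarrow> 'a \<Rightarrow> nat) \<Rightarrow> real \<Rightarrow> nat \<Rightarrow> nat \<Rightarrow> real" where
  "runs_pgf M X t n k = prob_space.expectation M (\<lambda>\<omega>. t ^ exact_runs n k (\<lambda>m. X m \<omega>))"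

lemma runs_pgf_eq_sum:
  assumes "q_sequence M X \<theta> q" and "k \<ge> 1"
  shows "runs_pgf M X t n k = (\<Sum>x\<le>n. t ^ x * \<P>(\<omega> in M. exact_runs n k (\<lambda>m. X m \<omega>) = x))"
proof -
  interpret prob_space M using assms by (simp add: q_sequence_def)
  define E where "E = (\<lambda>\<omega>. exact_runs n k (\<lambda>m. X m \<omega>))"
  have le: "exact_runs n k x \<le> n" for x
  proof -
    have "exact_runs n k x \<le> card {1..n}"
      unfolding exact_runs_def using assms(2) by (intro card_mono) auto
    then show ?thesis by simp
  qed
  have Xm: "X j \<in> M \<rightarrow>\<^sub>M count_space UNIV" if "j \<ge> 1" for j
  proof -
    have "X j \<in> M \<rightarrow>\<^sub>M count_space {0, 1}" using assms that by (simp add: q_sequence_def)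
    then show ?thesis by (rule measurable_compose) simp
  qed
  have E: "E \<in> M \<rightarrow>\<^sub>M count_space UNIV"
  proof -
    define P where "P = (\<lambda>i \<omega>. 1 \<le> i \<and> i + k \<le> n + 1 \<and> (\<forall>m\<in>{i..<i + k}. X m \<omega> = 1) \<and>
     (i = 1 \<or> X (i - 1) \<omega> = 0) \<and> (i + k = n + 1 \<or> X (i + k) \<omega> = 0))"
    have P: "Measurable.pred M (P i)" for i
    proof (cases "i \<ge> 1")
      case True
      have pred: "Measurable.pred M (\<lambda>\<omega>. X m \<omega> = c)" if "m \<ge> 1" for m c
        using measurable_compose[OF Xm[OF that], of "\<lambda>y. y = c" "count_space UNIV"] by simp
      have a: "Measurable.pred M (\<lambda>\<omega>. i = 1 \<or> X (i - 1) \<omega> = 0)"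
      proof (cases "i = 1")
        case False
        then have "i - 1 \<ge> 1" using True by simp
        from pred[OF this] show ?thesis by (intro pred_intros_logic(5) measurable_const) auto
      qed simp
      have b: "Measurable.pred M (\<lambda>\<omega>. i + k = n + 1 \<or> X (i + k) \<omega> = 0)"
        using True by (intro pred_intros_logic(5) measurable_const pred) auto
      have c: "Measurable.pred M (\<lambda>\<omega>. \<forall>m\<in>{i..<i + k}. X m \<omega> = 1)"
        using True by (intro pred_intros_finite(3) pred) auto
      show ?thesis
      proof (cases "i + k \<le> n + 1")
        case le: True
        have "P i = (\<lambda>\<omega>. (\<forall>m\<in>{i..<i + k}. X m \<omega> = 1) \<and>
            (i = 1 \<or> X (i - 1) \<omega> = 0) \<and> (i + k = n + 1 \<or> X (i + k) \<omega> = 0))"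
          using True le by (simp only: P_def simp_thms)
        then show ?thesis by (simp only: pred_intros_logic(3)[OF c pred_intros_logic(3)[OF a b]])
      next
        case False
        then have "P i = (\<lambda>\<omega>. False)" by (simp only: P_def simp_thms)
        then show ?thesis by simp
      qed
    qed (auto simp: P_def)
    have "E \<omega> = (\<Sum>i\<in>{1..n}. if P i \<omega> then 1 else 0)" for \<omega>
    proof -
      have "{i. P i \<omega>} = {i \<in> {1..n}. P i \<omega>}" using assms(2) by (auto simp: P_def)
      then have "E \<omega> = card {i \<in> {1..n}. P i \<omega>}" by (simp add: E_def exact_runs_def P_def)
      then show ?thesis by (simp flip: sum.inter_filter)
    qed
    then have *: "E = (\<lambda>\<omega>. \<Sum>i\<in>{1..n}. if P i \<omega> then 1 else 0)" by (rule ext)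
    note P [measurable]
    show ?thesis unfolding * by measurable
  qed
  note E [measurable]
  have "runs_pgf M X t n k = expectation (\<lambda>\<omega>. \<Sum>x\<le>n. t ^ x * indicator {\<omega>\<in>space M. E \<omega> = x} \<omega>)"
    unfolding runs_pgf_def
  proof (rule Bochner_Integration.integral_cong[OF refl])
    fix \<omega> assume "\<omega> \<in> space M"
    then have "(\<Sum>x\<le>n. t ^ x * indicator {\<omega>\<in>space M. E \<omega> = x} \<omega>) = (\<Sum>x\<le>n. if x = E \<omega> then t ^ x else 0)"
      by (intro sum.cong) (auto simp: indicator_def)
    also have "\<dots> = t ^ E \<omega>" using le by (simp add: E_def)
    finally show "t ^ exact_runs n k (\<lambda>m. X m \<omega>) = (\<Sum>x\<le>n. t ^ x * indicator {\<omega>\<in>space M. E \<omega> = x} \<omega>)"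
      by (simp add: E_def)
  qed
  also have "\<dots> = (\<Sum>x\<le>n. t ^ x * \<P>(\<omega> in M. E \<omega> = x))"
    by (subst Bochner_Integration.integral_sum) (auto intro!: integrable_mult_right simp: less_top[symmetric])
  finally show ?thesis by (simp add: E_def)
qed
text \<open>A realisation of the model, so that \<open>q_sequence\<close> is satisfiable: for independent
  \<open>u 1, u 2, \<dots>\<close> uniform on \<open>[0, 1]\<close>, trial \<open>j\<close> succeeds iff \<open>u j < \<theta> q\<^sup>z\<close>,
  where \<open>z\<close> is the number of earlier failures.\<close>

primrec unif_fails :: "real \<Rightarrow> real \<Rightarrow> (nat \<Rightarrow> real) \<Rightarrow> nat \<Rightarrow> nat" where
  "unif_fails \<theta> q u 0 = 0"
| "unif_fails \<theta> q u (Suc j) = unif_fails \<theta> q u j + (if u (Suc j) < \<theta> * q ^ unif_fails \<theta> q u j then 0 else 1)"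

definition unif_trial :: "real \<Rightarrow> real \<Rightarrow> nat \<Rightarrow> (nat \<Rightarrow> real) \<Rightarrow> nat" where
  "unif_trial \<theta> q j u = (if u j < \<theta> * q ^ unif_fails \<theta> q u (j - 1) then 1 else 0)"

lemma unif_fails_eq: "unif_fails \<theta> q u j = (\<Sum>m=1..<Suc j. 1 - unif_trial \<theta> q m u)"
  by (induction j) (auto simp: unif_trial_def)

lemma unif_fails_cong: "(\<And>m. m \<in> {1..<Suc j} \<Longrightarrow> u m = v m) \<Longrightarrow> unif_fails \<theta> q u j = unif_fails \<theta> q v j"
  by (induction j) auto

lemma unif_trial_cong: "j \<ge> 1 \<Longrightarrow> (\<And>m. m \<in> {1..<Suc j} \<Longrightarrow> u m = v m) \<Longrightarrow> unif_trial \<theta> q j u = unif_trial \<theta> q j v"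
  using unif_fails_cong[of "j - 1" u v \<theta> q] by (auto simp: unif_trial_def)

lemma unif_fails_measurable:
  assumes "{1..<Suc j} \<subseteq> I" 
  shows "(\<lambda>u. unif_fails \<theta> q u j) \<in> PiM I (\<lambda>_. borel) \<rightarrow>\<^sub>M count_space UNIV"
  using assms
proof (induction j)
  case (Suc j)
  have fails_j [measurable]: "(\<lambda>u. unif_fails \<theta> q u j) \<in> PiM I (\<lambda>_. borel) \<rightarrow>\<^sub>M count_space UNIV"
    using Suc.prems by (intro Suc.IH) auto
  have [measurable]: "(\<lambda>u. u (Suc j)) \<in> PiM I (\<lambda>_. borel) \<rightarrow>\<^sub>M (borel :: real measure)"
    using Suc.prems by (intro measurable_component_singleton) auto
  have [measurable]: "(\<lambda>u. \<theta> * q ^ unif_fails \<theta> q u j) \<in> borel_measurable (PiM I (\<lambda>_. borel))"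
    by (rule measurable_compose[OF fails_j]) simp
  have [simp]: "Suc j \<in> I" using Suc.prems by auto
  show ?case unfolding unif_fails.simps by measurable
qed simp

lemma unif_trial_measurable:
  assumes "j \<ge> 1" "{1..<Suc j} \<subseteq> I" 
  shows "unif_trial \<theta> q j \<in> PiM I (\<lambda>_. borel) \<rightarrow>\<^sub>M count_space UNIV"
proof -
  have fails_j: "(\<lambda>u. unif_fails \<theta> q u (j - 1)) \<in> PiM I (\<lambda>_. borel) \<rightarrow>\<^sub>M count_space UNIV"
    using assms by (intro unif_fails_measurable) auto
  have [measurable]: "(\<lambda>u. u j) \<in> PiM I (\<lambda>_. borel) \<rightarrow>\<^sub>M (borel :: real measure)"
    using assms by (intro measurable_component_singleton) auto
  have [measurable]: "(\<lambda>u. \<theta> * q ^ unif_fails \<theta> q u (j - 1)) \<in> borel_measurable (PiM I (\<lambda>_. borel))"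
    by (rule measurable_compose[OF fails_j]) simp
  have [simp]: "j \<in> I" using assms by auto
  show ?thesis unfolding unif_trial_def[abs_def] by measurable
qed

lemma q_sequence_exists:
  assumes "0 < q" "q \<le> 1" "0 \<le> \<theta>" "\<theta> \<le> 1"
  shows "\<exists>(M :: (nat \<Rightarrow> real) measure) X. q_sequence M X \<theta> q"
proof -
  define U where "U = (\<lambda>_::nat. uniform_measure lborel {0..1::real})"
  have psU: "prob_space (U i)" for i
    unfolding U_def by (rule prob_space_uniform_measure) auto
  define M where "M = PiM UNIV U"
  have sU [measurable_cong]: "sets (U i) = sets borel" for i by (simp add: U_def)
  interpret M: prob_space M unfolding M_def by (rule prob_space_PiM) (rule psU)
  have sM: "sets M = sets (PiM UNIV (\<lambda>_. borel))"
    unfolding M_def by (intro sets_PiM_cong) (auto simp: sU)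
  have spM: "space M = UNIV" by (simp add: M_def space_PiM U_def)
  have indep: "M.indep_vars U (\<lambda>i u. u i) UNIV"
    unfolding M_def
  proof (subst prob_space.indep_vars_iff_distr_eq_PiM, goal_cases)
    case 4
    have "distr (PiM UNIV U) (U i) (\<lambda>u. u i) = U i" for i
      using distr_PiM_component[of UNIV U i] psU by simp
    then show ?case by (simp add: restrict_UNIV distr_id)
  qed (auto intro!: prob_space_PiM psU)
  have Xm: "unif_trial \<theta> q j \<in> M \<rightarrow>\<^sub>M count_space UNIV" if "j \<ge> 1" for j
    using unif_trial_measurable[of j UNIV \<theta> q] that by (simp add: measurable_cong_sets[OF sM refl])
  have "q_sequence M (unif_trial \<theta> q) \<theta> q"
    unfolding q_sequence_def
  proof (intro conjI allI impI ballI)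
    show "prob_space M" by (rule M.prob_space_axioms)
  next
    fix j :: nat assume "j \<ge> 1"
    then show "unif_trial \<theta> q j \<in> M \<rightarrow>\<^sub>M count_space {0, 1}"
      using Xm[of j] by (auto simp: measurable_count_space_eq2 unif_trial_def intro: measurable_sets)
  next
    fix j :: nat and x :: "nat \<Rightarrow> nat"
    assume j: "j \<ge> 1" and pos: "\<P>(\<omega> in M. \<forall>m\<in>{1..<j}. unif_trial \<theta> q m \<omega> = x m) > 0"
    define z where "z = (\<Sum>m=1..<j. 1 - x m)"
    define c where "c = \<theta> * q ^ z"
    define A where "A = {u \<in> space (PiM {1..<j} U). \<forall>m\<in>{1..<j}. unif_trial \<theta> q m u = x m}"
    have spA: "space (PiM {1..<j} U) = space (PiM {1..<j} (\<lambda>_. borel))"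
      by (simp add: space_PiM U_def)
    have A: "A \<in> sets (PiM {1..<j} U)"
    proof -
      have s: "sets (PiM {1..<j} U) = sets (PiM {1..<j} (\<lambda>_. borel))"
        by (intro sets_PiM_cong) (auto simp: sU)
      have [measurable]: "unif_trial \<theta> q m \<in> PiM {1..<j} (\<lambda>_. borel) \<rightarrow>\<^sub>M count_space UNIV" 
        if "m \<in> {1..<j}" for m
        using that by (intro unif_trial_measurable) auto
      show ?thesis unfolding s A_def spA by measurable
    qed
    define B where "B = {u \<in> space (PiM {j} U). u j < c}"
    have B: "B \<in> sets (PiM {j} U)" unfolding B_def by measurable
    have iv: "M.indep_var (PiM {1..<j} U) (\<lambda>u. restrict u {1..<j}) (PiM {j} U) (\<lambda>u. restrict u {j})"
      using M.indep_var_restrict[OF indep, of "{1..<j}" "{j}"] by simp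
    have hist: "(\<lambda>u. restrict u {1..<j}) -` A \<inter> space M = {\<omega>\<in>space M. \<forall>m\<in>{1..<j}. unif_trial \<theta> q m \<omega> = x m}"
    proof -
      have "unif_trial \<theta> q m (restrict u {1..<j}) = unif_trial \<theta> q m u" if "m \<in> {1..<j}" for m u
        using that by (intro unif_trial_cong) auto
      then show ?thesis by (auto simp: A_def spM space_PiM U_def)
    qed
    have c: "0 \<le> c" "c \<le> 1"
      using assms by (auto simp: c_def intro!: mult_le_one power_le_one)
    have pB: "M.prob ((\<lambda>u. restrict u {j}) -` B \<inter> space M) = c"
    proof -
      have "M.prob ((\<lambda>u. restrict u {j}) -` B \<inter> space M) = measure (distr M (U j) (\<lambda>u. u j)) {..<c}"
        by (subst measure_distr) (auto simp: M_def B_def space_PiM U_def intro!: arg_cong[where f="measure _"])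
      also have "distr M (U j) (\<lambda>u. u j) = U j" unfolding M_def by (rule distr_PiM_component) (auto intro: psU)
      also have "measure (U j) {..<c} = measure lborel ({0..1} \<inter> {..<c}) / measure lborel {0..1::real}"
        unfolding U_def by (rule measure_uniform_measure) auto
      also have "{0..1} \<inter> {..<c} = {0..<c}" using c by auto
      also have "measure lborel {0..<c} / measure lborel {0..1::real} = c" using c by simp
      finally show ?thesis .
    qed
    have both: "{\<omega>\<in>space M. unif_trial \<theta> q j \<omega> = 1 \<and> (\<forall>m\<in>{1..<j}. unif_trial \<theta> q m \<omega> = x m)}
        = (\<lambda>u. (restrict u {1..<j}, restrict u {j})) -` (A \<times> B) \<inter> space M"
    proof -
      have "unif_trial \<theta> q j u = 1 \<longleftrightarrow> u j < c" if "\<forall>m\<in>{1..<j}. unif_trial \<theta> q m u = x m" for u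
      proof -
        have "unif_fails \<theta> q u (j - 1) = z"
          using that j by (simp add: unif_fails_eq z_def)
        then show ?thesis by (simp add: unif_trial_def c_def)
      qed
      then have "{\<omega>\<in>space M. unif_trial \<theta> q j \<omega> = 1 \<and> (\<forall>m\<in>{1..<j}. unif_trial \<theta> q m \<omega> = x m)}
        = {\<omega>\<in>space M. \<forall>m\<in>{1..<j}. unif_trial \<theta> q m \<omega> = x m} \<inter> {u. u j < c}" by blast
      also have "{u. u j < c} = (\<lambda>u. restrict u {j}) -` B"
        by (auto simp: B_def space_PiM U_def)
      finally show ?thesis unfolding hist[symmetric] by blast
    qed
    show "\<P>(\<omega> in M. unif_trial \<theta> q j \<omega> = 1 \<bar> \<forall>m\<in>{1..<j}. unif_trial \<theta> q m \<omega> = x m)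
        = \<theta> * q ^ (\<Sum>m=1..<j. 1 - x m)"
      using pos unfolding cond_prob_def both M.indep_varD[OF iv A B] hist pB
      by (simp add: c_def z_def)
  qed
  then show ?thesis by blast
qed

end

theory Submission
  imports Defs
begin

text \<open>Condition on the number \<open>j\<close> of ones before the first failure: a run of length exactly \<open>k\<close>
  is completed there iff \<open>j = k\<close>, and the remaining trials form a \<open>q\<close>-sequence with parameter
  \<open>\<theta> q\<close>. With \<open>\<phi>(n)\<close> and \<open>\<psi>(n)\<close> the generating functions for \<open>\<theta>\<close> and \<open>\<theta> q\<close>, this gives
  \<open>\<phi>(n) = (1 - \<theta>) (\<Sum>j<n. \<theta>\<^sup>j t\<^bsup>[j = k]\<^esup> \<psi>(n - 1 - j)) + \<theta>\<^sup>n t\<^bsup>[n = k]\<^esup>\<close>.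
  In \<open>\<phi>(n) - \<theta> \<phi>(n - 1)\<close> the sums telescope, up to the terms that carry the weight \<open>t\<close>.\<close>

section \<open>Expectations over binary words\<close>

fun word_expectation :: "real \<Rightarrow> nat \<Rightarrow> real \<Rightarrow> (nat list \<Rightarrow> real) \<Rightarrow> real" where
  "word_expectation q 0 \<theta> g = g []"
| "word_expectation q (Suc n) \<theta> g =
     \<theta> * word_expectation q n \<theta> (\<lambda>l. g (1 # l)) + (1 - \<theta>) * word_expectation q n (\<theta> * q) (\<lambda>l. g (0 # l))"

lemma word_expectation_cmult:
  "word_expectation q n \<theta> (\<lambda>l. c * g l) = c * word_expectation q n \<theta> g"
  by (induction n arbitrary: \<theta> g) (simp_all add: algebra_simps)

text \<open>The model specifies the last trial given its history, whereas \<open>word_expectation\<close> recurses on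
  the first trial. The two orders agree because a first failure replaces \<open>\<theta>\<close> by \<open>\<theta> q\<close> in all later
  success probabilities.\<close>

lemma word_expectation_snoc:
  "word_expectation q (Suc n) \<theta> g = word_expectation q n \<theta>
     (\<lambda>l. \<theta> * q ^ count_list l 0 * g (l @ [1]) + (1 - \<theta> * q ^ count_list l 0) * g (l @ [0]))"
proof (induction n arbitrary: \<theta> g)
  case (Suc n)
  show ?case
    unfolding word_expectation.simps(2)[of q "Suc n" \<theta> g]
      Suc[of \<theta> "\<lambda>l. g (1 # l)"] Suc[of "\<theta> * q" "\<lambda>l. g (0 # l)"]
    by (simp add: mult.assoc)
qed simp

text \<open>The success probability stays \<open>\<theta>\<close> until a failure occurs, so
  \<open>j\<close> leading ones and then a zero have weight
  \<open>\<theta> ^ j * (1 - \<theta>)\<close>. The last term belongs to the word without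
  failures.\<close>

lemma word_expectation_first_failure:
  "word_expectation q n \<theta> g =
     (\<Sum>j<n. \<theta> ^ j * (1 - \<theta>) * word_expectation q (n - 1 - j) (\<theta> * q) (\<lambda>l. g (replicate j 1 @ 0 # l)))
     + \<theta> ^ n * g (replicate n 1)"
proof (induction n arbitrary: g)
  case (Suc n)
  have "word_expectation q (Suc n) \<theta> g =
      \<theta> * ((\<Sum>j<n. \<theta> ^ j * (1 - \<theta>)
        * word_expectation q (n - 1 - j) (\<theta> * q) (\<lambda>l. g (1 # replicate j 1 @ 0 # l)))
      + \<theta> ^ n * g (1 # replicate n 1)) + (1 - \<theta>) * word_expectation q n (\<theta> * q) (\<lambda>l. g (0 # l))"
    by (simp only: word_expectation.simps Suc[of "\<lambda>l. g (1 # l)"])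
  \<comment> \<open>The summand \<open>j = 0\<close> is the failure branch; the later ones take up
    the factor \<open>\<theta>\<close> of the success branch.\<close>
  then show ?case
    by (subst sum.lessThan_Suc_shift)
      (simp add: sum_distrib_left distrib_left mult.assoc del: word_expectation.simps)
qed simp

section \<open>From the probability space to words\<close>

text \<open>The histories \<open>L n\<close> cut the space into finitely many atoms, and on each
  atom the model gives the law of the next trial.\<close>

lemma q_sequence_expectation_snoc:
  fixes g :: "nat list \<Rightarrow> real"
  assumes qs: "q_sequence M X \<theta> q"
  defines "L \<equiv> \<lambda>n \<omega>. map (\<lambda>m. X m \<omega>) [1..<Suc n]"
  shows "prob_space.expectation M (\<lambda>\<omega>. g (L (Suc n) \<omega>)) =
    prob_space.expectation M (\<lambda>\<omega>. \<theta> * q ^ count_list (L n \<omega>) 0 * g (L n \<omega> @ [1])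
      + (1 - \<theta> * q ^ count_list (L n \<omega>) 0) * g (L n \<omega> @ [0]))"
proof -
  interpret prob_space M using qs by (simp add: q_sequence_def)
  define W where "W = {l :: nat list. set l \<subseteq> {0, 1} \<and> length l = n}"
  have finW: "finite W" unfolding W_def by (rule finite_lists_length_eq) simp
  have X01: "X j \<in> M \<rightarrow>\<^sub>M count_space {0, 1}" if "j \<ge> 1" for j
    using qs that by (simp add: q_sequence_def)
  have Xval: "X j \<omega> \<in> {0, 1}" if "j \<ge> 1" "\<omega> \<in> space M" for j \<omega>
    using measurable_space[OF X01[OF that(1)] that(2)] by simp
  have pred: "Measurable.pred M (\<lambda>\<omega>. X m \<omega> = c)" if "m \<ge> 1" for m c
  proof -
    have "X m \<in> M \<rightarrow>\<^sub>M count_space UNIV"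
      using X01[OF that] by (rule measurable_compose) simp
    then show ?thesis by measurable
  qed
  have LW: "L n \<omega> \<in> W" if "\<omega> \<in> space M" for \<omega>
  proof -
    have "X m \<omega> \<in> {0, 1}" if "m \<in> set [1..<Suc n]" for m
    proof -
      have "1 \<le> m" using that by (simp del: upt_Suc)
      then show ?thesis using \<open>\<omega> \<in> space M\<close> by (rule Xval)
    qed
    then have "set (L n \<omega>) \<subseteq> {0, 1}" unfolding L_def set_map by (rule image_subsetI)
    then show ?thesis by (simp add: W_def L_def)
  qed
  \<comment> \<open>Brings an atom into the form in which \<open>q_sequence\<close> states
    histories; trials count from 1, list entries from 0.\<close>
  have L_iff: "L n \<omega> = l \<longleftrightarrow> (\<forall>m\<in>{1..<Suc n}. X m \<omega> = l ! (m - 1))" if "l \<in> W" for l \<omega>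
  proof -
    have "L n \<omega> = l \<longleftrightarrow> (\<forall>i<n. X (Suc i) \<omega> = l ! i)"
      using that by (auto simp: L_def W_def list_eq_iff_nth_eq simp del: upt_Suc)
    also have "\<dots> \<longleftrightarrow> (\<forall>m\<in>{1..<Suc n}. X m \<omega> = l ! (m - 1))"
    proof (intro iffI ballI allI impI)
      fix m assume "\<forall>i<n. X (Suc i) \<omega> = l ! i" "m \<in> {1..<Suc n}"
      then show "X m \<omega> = l ! (m - 1)" by (cases m) auto
    next
      fix i assume *: "\<forall>m\<in>{1..<Suc n}. X m \<omega> = l ! (m - 1)" and "i < n"
      then have "Suc i \<in> {1..<Suc n}" by simp
      from bspec[OF * this] show "X (Suc i) \<omega> = l ! i" by simp
    qed
    finally show ?thesis .
  qed
  have predL: "Measurable.pred M (\<lambda>\<omega>. L n \<omega> = l)" if "l \<in> W" for l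
    unfolding L_iff[OF that] by (intro pred_intros_finite(3) pred) auto
  define A where "A = (\<lambda>l. {\<omega> \<in> space M. L n \<omega> = l})"
  define B where "B = {\<omega> \<in> space M. X (Suc n) \<omega> = 1}"
  have A: "A l \<in> sets M" if "l \<in> W" for l
    using predL[OF that] by (simp add: A_def pred_def)
  have B: "B \<in> sets M"
    using pred[of "Suc n" 1] by (simp add: B_def pred_def)
  \<comment> \<open>The model says nothing about null histories, but there both sides
    vanish.\<close>
  have prob_AB: "prob (A l \<inter> B) = \<theta> * q ^ count_list l 0 * prob (A l)" if l: "l \<in> W" for l
  proof (cases "prob (A l) > 0")
    case False
    then have "prob (A l) = 0" using measure_nonneg[of M "A l"] by linarith
    moreover have "prob (A l \<inter> B) \<le> prob (A l)"
      using A[OF l] by (intro finite_measure_mono) auto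
    ultimately show ?thesis using measure_nonneg[of M "A l \<inter> B"] by simp
  next
    case True
    define x where "x = (\<lambda>m. l ! (m - 1))"
    have A_eq: "A l = {\<omega> \<in> space M. \<forall>m\<in>{1..<Suc n}. X m \<omega> = x m}"
      by (simp only: A_def L_iff[OF l] x_def)
    have AB_eq: "A l \<inter> B = {\<omega> \<in> space M. X (Suc n) \<omega> = 1 \<and> (\<forall>m\<in>{1..<Suc n}. X m \<omega> = x m)}"
      unfolding A_eq B_def by blast
    have "x m \<in> {0, 1}" if "m \<in> {1..<Suc n}" for m
    proof -
      have "l ! (m - 1) \<in> set l" using l that by (intro nth_mem) (auto simp: W_def)
      then show ?thesis using l by (auto simp: W_def x_def)
    qed
    then have "x \<in> {1..<Suc n} \<rightarrow> {0, 1}" by blast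
    then have "\<P>(\<omega> in M. X (Suc n) \<omega> = 1 \<bar> \<forall>m\<in>{1..<Suc n}. X m \<omega> = x m)
        = \<theta> * q ^ (\<Sum>m=1..<Suc n. 1 - x m)"
      using qs True unfolding A_eq q_sequence_def by simp
    then have "prob (A l \<inter> B) / prob (A l) = \<theta> * q ^ (\<Sum>m=1..<Suc n. 1 - x m)"
      unfolding cond_prob_def AB_eq[symmetric] A_eq[symmetric] .
    \<comment> \<open>Entries are 0 or 1, so the truncated difference \<open>1 - x m\<close> is the
      indicator of a failure.\<close>
    moreover have "(\<Sum>m=1..<Suc n. 1 - x m) = count_list l 0"
    proof -
      have "(\<Sum>m=1..<Suc n. 1 - x m) = (\<Sum>i<n. 1 - l ! i)"
        unfolding One_nat_def sum.shift_bounds_Suc_ivl by (simp add: x_def atLeast0LessThan)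
      also have "\<dots> = sum_list (map (\<lambda>b. 1 - b) l)"
        using l by (simp add: sum_list_sum_nth W_def atLeast0LessThan)
      also have "\<dots> = count_list l 0"
      proof -
        have "set l \<subseteq> {0, 1}" using l by (simp add: W_def)
        then show ?thesis by (induction l) auto
      qed
      finally show ?thesis .
    qed
    ultimately show ?thesis using True by (simp add: field_simps)
  qed
  have split: "h (L n \<omega>) = (\<Sum>l\<in>W. indicator (A l) \<omega> * h l)" if "\<omega> \<in> space M"
    for \<omega> and h :: "nat list \<Rightarrow> real"
  proof -
    have "(\<Sum>l\<in>W. indicator (A l) \<omega> * h l) = (\<Sum>l\<in>W. if l = L n \<omega> then h l else 0)"
      using that by (intro sum.cong) (auto simp: A_def)
    then show ?thesis using finW LW[OF that] by simp
  qed
  \<comment> \<open>On \<open>A l\<close> failure is the complement of \<open>B\<close>; writing its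
    indicator as a difference leaves only the probabilities known from
    \<open>prob_AB\<close>.\<close>
  have "expectation (\<lambda>\<omega>. g (L (Suc n) \<omega>)) = expectation (\<lambda>\<omega>. \<Sum>l\<in>W.
      g (l @ [1]) * indicator (A l \<inter> B) \<omega> + g (l @ [0]) * (indicator (A l) \<omega> - indicator (A l \<inter> B) \<omega>))"
  proof (rule Bochner_Integration.integral_cong[OF refl])
    fix \<omega> assume \<omega>: "\<omega> \<in> space M"
    have "g (L (Suc n) \<omega>) = (\<Sum>l\<in>W. indicator (A l) \<omega> * g (l @ [X (Suc n) \<omega>]))"
      using split[OF \<omega>, of "\<lambda>l. g (l @ [X (Suc n) \<omega>])"] by (simp add: L_def)
    also have "\<dots> = (\<Sum>l\<in>W. g (l @ [1]) * indicator (A l \<inter> B) \<omega>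
        + g (l @ [0]) * (indicator (A l) \<omega> - indicator (A l \<inter> B) \<omega>))"
      using Xval[of "Suc n" \<omega>] \<omega> by (intro sum.cong) (auto simp: B_def indicator_def)
    finally show "g (L (Suc n) \<omega>) = \<dots>" .
  qed
  also have "\<dots> = (\<Sum>l\<in>W. g (l @ [1]) * prob (A l \<inter> B) + g (l @ [0]) * (prob (A l) - prob (A l \<inter> B)))"
    using A B by (simp add: less_top[symmetric])
  also have "\<dots> = (\<Sum>l\<in>W. prob (A l) * (\<theta> * q ^ count_list l 0 * g (l @ [1])
      + (1 - \<theta> * q ^ count_list l 0) * g (l @ [0])))"
    by (intro sum.cong refl) (simp add: prob_AB algebra_simps)
  also have "\<dots> = expectation (\<lambda>\<omega>. \<Sum>l\<in>W. indicator (A l) \<omega> * (\<theta> * q ^ count_list l 0 * g (l @ [1])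
      + (1 - \<theta> * q ^ count_list l 0) * g (l @ [0])))"
    using A by (simp add: less_top[symmetric])
  also have "\<dots> = expectation (\<lambda>\<omega>. \<theta> * q ^ count_list (L n \<omega>) 0 * g (L n \<omega> @ [1])
      + (1 - \<theta> * q ^ count_list (L n \<omega>) 0) * g (L n \<omega> @ [0]))"
    by (rule Bochner_Integration.integral_cong[OF refl], rule split[symmetric])
  finally show ?thesis .
qed

text \<open>Both sides lose their last trial by the same formula, which changes \<open>g\<close>;
  hence the induction over arbitrary \<open>g\<close>.\<close>

lemma q_sequence_expectation:
  fixes g :: "nat list \<Rightarrow> real"
  assumes "q_sequence M X \<theta> q"
  shows "prob_space.expectation M (\<lambda>\<omega>. g (map (\<lambda>m. X m \<omega>) [1..<Suc n])) = word_expectation q n \<theta> g"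
proof (induction n arbitrary: g)
  case 0
  interpret prob_space M using assms by (simp add: q_sequence_def)
  show ?case by (simp add: prob_space)
next
  case (Suc n)
  show ?case
    by (simp only: q_sequence_expectation_snoc[OF assms] word_expectation_snoc Suc[symmetric])
qed

section \<open>Counting runs across the first failure\<close>

text \<open>The disjuncts \<open>i = 1\<close> and \<open>i + k = n + 1\<close> shield the positions
  \<open>0\<close> and \<open>n + 1\<close>, so whatever \<open>l ! (m - 1)\<close> yields outside a
  word is harmless.\<close>

lemma exact_runs_cong:
  assumes "\<And>m. 1 \<le> m \<Longrightarrow> m \<le> n \<Longrightarrow> x m = y m"
  shows "exact_runs n k x = exact_runs n k y"
proof -
  have "(1 \<le> i \<and> i + k \<le> n + 1 \<and> (\<forall>m\<in>{i..<i + k}. x m = 1) \<and>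
       (i = 1 \<or> x (i - 1) = 0) \<and> (i + k = n + 1 \<or> x (i + k) = 0)) \<longleftrightarrow>
     (1 \<le> i \<and> i + k \<le> n + 1 \<and> (\<forall>m\<in>{i..<i + k}. y m = 1) \<and>
       (i = 1 \<or> y (i - 1) = 0) \<and> (i + k = n + 1 \<or> y (i + k) = 0))" for i
  proof (cases "1 \<le> i \<and> i + k \<le> n + 1")
    case True
    have "\<forall>m\<in>{i..<i + k}. x m = y m" using True assms by auto
    moreover have "i = 1 \<or> x (i - 1) = y (i - 1)" using True assms[of "i - 1"] by linarith
    moreover have "i + k = n + 1 \<or> x (i + k) = y (i + k)" using True assms[of "i + k"] by linarith
    ultimately show ?thesis by auto
  qed auto
  then show ?thesis unfolding exact_runs_def by presburger
qed

lemma exact_runs_all_ones: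
  assumes "k \<ge> 1" "\<And>m. 1 \<le> m \<Longrightarrow> m \<le> n \<Longrightarrow> x m = 1"
  shows "exact_runs n k x = of_bool (n = k)"
proof -
  have "{i. 1 \<le> i \<and> i + k \<le> n + 1 \<and> (i = 1 \<or> (1::nat) = 0) \<and> (i + k = n + 1 \<or> (1::nat) = 0)}
      = (if n = k then {1} else {})"
    using assms(1) by auto
  then have "exact_runs n k (\<lambda>_. 1) = of_bool (n = k)"
    by (simp add: exact_runs_def)
  moreover have "exact_runs n k x = exact_runs n k (\<lambda>_. 1)"
    using assms(2) by (rule exact_runs_cong)
  ultimately show ?thesis by simp
qed

text \<open>No block contains the zero at \<open>Suc j\<close>. One that starts before it must fill
  all \<open>j\<close> leading ones; those after it are the blocks of the rest, shifted by
  \<open>Suc j\<close>.\<close>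

lemma exact_runs_first_failure:
  assumes ones: "\<And>m. 1 \<le> m \<Longrightarrow> m \<le> j \<Longrightarrow> x m = 1" and zero: "x (Suc j) = 0"
  shows "exact_runs (Suc j + n) k x = of_bool (j = k) + exact_runs n k (\<lambda>m. x (Suc j + m))"
proof -
  define R where "R = (\<lambda>n (x :: nat \<Rightarrow> nat) i. 1 \<le> i \<and> i + k \<le> n + 1 \<and> (\<forall>m\<in>{i..<i + k}. x m = 1) \<and>
     (i = 1 \<or> x (i - 1) = 0) \<and> (i + k = n + 1 \<or> x (i + k) = 0))"
  let ?y = "\<lambda>m. x (Suc j + m)"
  have early: "i = 1 \<and> j = k" if R: "R (Suc j + n) x i" and i: "i \<le> Suc j" for i
  proof -
    have "i + k \<le> Suc j"
    proof (rule ccontr)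
      assume "\<not> ?thesis"
      then have "Suc j \<in> {i..<i + k}" using i by simp
      then have "x (Suc j) = 1" using R unfolding R_def by blast
      then show False using zero by simp
    qed
    moreover have "i = 1"
    proof (rule ccontr)
      assume "i \<noteq> 1"
      then have "x (i - 1) = 0" "1 \<le> i - 1" "i - 1 \<le> j" using R i unfolding R_def by auto
      then show False using ones[of "i - 1"] by simp
    qed
    moreover have "x (i + k) = 0"
    proof (cases "i + k = Suc j + n + 1")
      case True
      then show ?thesis using \<open>i + k \<le> Suc j\<close> by simp
    next
      case False
      then show ?thesis using R unfolding R_def by blast
    qed
    \<comment> \<open>Among the positions \<open>1\<close> to \<open>Suc j\<close> only
      \<open>Suc j\<close> holds a zero, so the block ends exactly at \<open>j\<close>.\<close>
    ultimately show ?thesis using ones[of "i + k"] by (cases "i + k \<le> j") auto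
  qed
  have first: "R (Suc j + n) x 1" if "j = k"
    using that ones zero by (auto simp: R_def)
  have shift: "R (Suc j + n) x (Suc j + i) \<longleftrightarrow> R n ?y i" if "1 \<le> i" for i
  proof -
    have "(\<forall>m\<in>{Suc j + i..<Suc j + i + k}. x m = 1) \<longleftrightarrow> (\<forall>m\<in>{i..<i + k}. ?y m = 1)"
    proof -
      have eq: "{Suc j + i..<Suc j + i + k} = (+) (Suc j) ` {i..<i + k}"
        by (simp only: image_add_atLeastLessThan add_ac)
      show ?thesis unfolding eq by blast
    qed
    \<comment> \<open>For \<open>i = 1\<close> the left neighbour is the zero itself, which acts as
      the beginning of the rest.\<close>
    moreover have "(Suc j + i = 1 \<or> x (Suc j + i - 1) = 0) \<longleftrightarrow> (i = 1 \<or> ?y (i - 1) = 0)"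
      using that zero by (cases "i = 1") auto
    moreover have "(Suc j + i + k = Suc j + n + 1 \<or> x (Suc j + i + k) = 0) \<longleftrightarrow>
        (i + k = n + 1 \<or> ?y (i + k) = 0)"
      by (simp add: add.assoc)
    ultimately show ?thesis using that unfolding R_def by auto
  qed
  have pos: "1 \<le> i" if "R n y i" for n y i using that by (simp add: R_def)
  have "{i. R (Suc j + n) x i} = (if j = k then {1} else {}) \<union> (+) (Suc j) ` {i. R n ?y i}"
  proof (intro set_eqI iffI)
    fix i assume "i \<in> {i. R (Suc j + n) x i}"
    then have i: "R (Suc j + n) x i" by simp
    show "i \<in> (if j = k then {1} else {}) \<union> (+) (Suc j) ` {i. R n ?y i}"
    proof (cases "i \<le> Suc j")
      case True
      then show ?thesis using early[OF i] by simp
    next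
      case False
      then have "1 \<le> i - Suc j" "i = Suc j + (i - Suc j)" by auto
      then have "R n ?y (i - Suc j)" using shift i by metis
      then show ?thesis using \<open>i = Suc j + (i - Suc j)\<close> by blast
    qed
  next
    fix i assume "i \<in> (if j = k then {1} else {}) \<union> (+) (Suc j) ` {i. R n ?y i}"
    then consider "i = 1" "j = k" | i' where "i = Suc j + i'" "R n ?y i'" by (auto split: if_splits)
    then show "i \<in> {i. R (Suc j + n) x i}"
      using first shift pos by cases blast+
  qed
  moreover have "card ((+) (Suc j) ` {i. R n ?y i}) = card {i. R n ?y i}"
    by (rule card_image) (simp add: inj_on_def)
  moreover have "finite {i. R n ?y i}"
    by (rule finite_subset[of _ "{..n + 1}"]) (auto simp: R_def)
  \<comment> \<open>Disjointness of the two parts: shifted starts exceed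
    \<open>Suc j\<close>.\<close>
  moreover have "1 \<notin> (+) (Suc j) ` {i. R n ?y i}" using pos by fastforce
  moreover have "card A = of_bool b + card C"
    if "A = (if b then {1} else {}) \<union> B" "card B = card C" "finite C" "1 \<notin> B" "B = (+) (Suc j) ` C"
    for A B C :: "nat set" and b
    using that by auto
  ultimately have "card {i. R (Suc j + n) x i} = of_bool (j = k) + card {i. R n ?y i}"
    by blast
  then show ?thesis unfolding exact_runs_def R_def .
qed

definition word_runs :: "nat \<Rightarrow> nat list \<Rightarrow> nat" where
  "word_runs k l = exact_runs (length l) k (\<lambda>m. l ! (m - 1))"

lemma word_runs_replicate: "k \<ge> 1 \<Longrightarrow> word_runs k (replicate n 1) = of_bool (n = k)"
  unfolding word_runs_def by (subst exact_runs_all_ones) auto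

lemma word_runs_first_failure:
  "word_runs k (replicate j 1 @ 0 # l) = of_bool (j = k) + word_runs k l"
proof -
  let ?x = "\<lambda>m. (replicate j 1 @ 0 # l) ! (m - 1)"
  have "exact_runs (Suc j + length l) k ?x
      = of_bool (j = k) + exact_runs (length l) k (\<lambda>m. ?x (Suc j + m))"
    by (rule exact_runs_first_failure) (auto simp: nth_append)
  also have "exact_runs (length l) k (\<lambda>m. ?x (Suc j + m)) = exact_runs (length l) k (\<lambda>m. l ! (m - 1))"
    by (rule exact_runs_cong) (auto simp: nth_append nth_Cons')
  finally show ?thesis by (simp add: word_runs_def)
qed

section \<open>The generating function on words and its recurrence\<close>

definition word_pgf :: "real \<Rightarrow> nat \<Rightarrow> real \<Rightarrow> nat \<Rightarrow> real \<Rightarrow> real" where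
  "word_pgf q k t n \<theta> = word_expectation q n \<theta> (\<lambda>l. t ^ word_runs k l)"

text \<open>Makes generating functions over unrelated probability spaces comparable: they become
  values of one function of the parameter.\<close>

lemma runs_pgf_eq_word_pgf:
  assumes "q_sequence M X \<theta> q"
  shows "runs_pgf M X t n k = word_pgf q k t n \<theta>"
proof -
  have "exact_runs n k (\<lambda>m. X m \<omega>) = word_runs k (map (\<lambda>m. X m \<omega>) [1..<Suc n])" for \<omega>
    unfolding word_runs_def length_map length_upt diff_Suc_1
    by (rule exact_runs_cong) (auto simp del: upt_Suc)
  then show ?thesis
    unfolding runs_pgf_def word_pgf_def
    by (simp only: q_sequence_expectation[OF assms, where g = "\<lambda>l. t ^ word_runs k l"])
qed

text \<open>The weight \<open>t\<close> of the summand \<open>j = k\<close> is split as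
  \<open>1 + (t - 1)\<close>. This leaves a uniform sum, which can telescope, and one correction,
  present only if \<open>k < n\<close>.\<close>

lemma word_pgf_first_failure:
  assumes "k \<ge> 1"
  shows "word_pgf q k t n \<theta> =
    (1 - \<theta>) * ((\<Sum>j<n. \<theta> ^ j * word_pgf q k t (n - 1 - j) (\<theta> * q))
      + of_bool (k < n) * (\<theta> ^ k * (t - 1) * word_pgf q k t (n - 1 - k) (\<theta> * q)))
    + \<theta> ^ n * t ^ of_bool (n = k)"
proof -
  let ?\<psi> = "\<lambda>j. word_pgf q k t (n - 1 - j) (\<theta> * q)"
  have "word_pgf q k t n \<theta> =
      (\<Sum>j<n. \<theta> ^ j * (1 - \<theta>) * (t ^ of_bool (j = k) * ?\<psi> j)) + \<theta> ^ n * t ^ of_bool (n = k)"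
    unfolding word_pgf_def
    by (subst word_expectation_first_failure)
      (simp only: word_runs_first_failure word_runs_replicate[OF assms] power_add
        word_expectation_cmult)
  also have "(\<Sum>j<n. \<theta> ^ j * (1 - \<theta>) * (t ^ of_bool (j = k) * ?\<psi> j)) =
      (\<Sum>j<n. (1 - \<theta>) * (\<theta> ^ j * ?\<psi> j) + (if j = k then (1 - \<theta>) * (\<theta> ^ k * (t - 1) * ?\<psi> k) else 0))"
    by (intro sum.cong) (auto simp: algebra_simps)
  also have "\<dots> = (1 - \<theta>) * ((\<Sum>j<n. \<theta> ^ j * ?\<psi> j) + of_bool (k < n) * (\<theta> ^ k * (t - 1) * ?\<psi> k))"
    by (simp add: sum.distrib distrib_left flip: sum_distrib_left)
  finally show ?thesis .
qed

text \<open>By induction all remainders contribute 1, and the geometric sum times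
  \<open>1 - \<theta>\<close>, plus \<open>\<theta> ^ n\<close>, is 1. The remainders have parameter
  \<open>\<theta> * q\<close>, so \<open>\<theta>\<close> is generalised.\<close>

lemma word_pgf_less:
  assumes "k \<ge> 1" "n < k"
  shows "word_pgf q k t n \<theta> = 1"
  using assms(2)
proof (induction n arbitrary: \<theta> rule: less_induct)
  case (less n)
  have "(\<Sum>j<n. \<theta> ^ j * word_pgf q k t (n - 1 - j) (\<theta> * q)) = (\<Sum>j<n. \<theta> ^ j)"
    using less.prems by (intro sum.cong refl) (simp add: less.IH)
  then show ?case
    using less.prems one_diff_power_eq[of \<theta> n]
    by (subst word_pgf_first_failure[OF assms(1)]) simp
qed

text \<open>After a failure fewer than \<open>k\<close> trials remain, so only the all-ones word
  carries \<open>t\<close>.\<close>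

lemma word_pgf_eq:
  assumes "k \<ge> 1"
  shows "word_pgf q k t k \<theta> = 1 + \<theta> ^ k * (t - 1)"
proof -
  have "(\<Sum>j<k. \<theta> ^ j * word_pgf q k t (k - 1 - j) (\<theta> * q)) = (\<Sum>j<k. \<theta> ^ j)"
    using assms by (intro sum.cong) (auto simp: word_pgf_less)
  then show ?thesis
    using one_diff_power_eq[of \<theta> k]
    by (subst word_pgf_first_failure[OF assms]) (simp add: algebra_simps)
qed

text \<open>The run comes before a final failure, with weight
  \<open>\<theta> ^ k * (1 - \<theta>)\<close>, or after an initial one, with weight
  \<open>(1 - \<theta>) * (\<theta> * q) ^ k\<close>.\<close>

lemma word_pgf_Suc:
  assumes "k \<ge> 1"
  shows "word_pgf q k t (Suc k) \<theta> = 1 + \<theta> ^ k * (1 - \<theta>) * (1 + q ^ k) * (t - 1)"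
proof -
  have "(\<Sum>j<k. \<theta> ^ j * word_pgf q k t (k - 1 - j) (\<theta> * q)) = (\<Sum>j<k. \<theta> ^ j)"
    using assms by (intro sum.cong) (auto simp: word_pgf_less)
  \<comment> \<open>Only \<open>j = 0\<close> leaves a remainder of length \<open>k\<close>; all
    others are shorter and give 1.\<close>
  then have "(\<Sum>j<Suc k. \<theta> ^ j * word_pgf q k t (Suc k - 1 - j) (\<theta> * q))
      = 1 + (\<theta> * q) ^ k * (t - 1) + \<theta> * (\<Sum>j<k. \<theta> ^ j)"
    by (subst sum.lessThan_Suc_shift) (simp add: word_pgf_eq[OF assms] mult.assoc flip: sum_distrib_left)
  then have "word_pgf q k t (Suc k) \<theta> = (1 - \<theta>) *
      (1 + (\<theta> * q) ^ k * (t - 1) + \<theta> * (\<Sum>j<k. \<theta> ^ j) + \<theta> ^ k * (t - 1)) + \<theta> ^ Suc k"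
    using assms
    by (subst word_pgf_first_failure[OF assms]) (simp add: word_pgf_less)
  also have "\<dots> = (1 - \<theta>) * (1 + (\<theta> * q) ^ k * (t - 1) + \<theta> ^ k * (t - 1))
      + \<theta> * ((1 - \<theta>) * (\<Sum>j<k. \<theta> ^ j)) + \<theta> ^ Suc k"
    by (simp only: distrib_left mult.left_commute add_ac)
  finally show ?thesis
    unfolding one_diff_power_eq[symmetric] by (simp add: power_mult_distrib algebra_simps)
qed

lemma word_pgf_recurrence:
  assumes "k \<ge> 1" "n > k + 1"
  shows "word_pgf q k t n \<theta> = \<theta> * word_pgf q k t (n - 1) \<theta>
    + (1 - \<theta>) * (word_pgf q k t (n - 1) (\<theta> * q)
      + \<theta> ^ k * (t - 1) * word_pgf q k t (n - k - 1) (\<theta> * q)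
      + \<theta> ^ (k + 1) * (1 - t) * word_pgf q k t (n - k - 2) (\<theta> * q))"
proof -
  obtain m where n: "n = Suc m" and m: "m > k" using assms(2) by (cases n) auto
  let ?\<psi> = "\<lambda>m. word_pgf q k t m (\<theta> * q)"
  \<comment> \<open>\<open>S\<close> is the uniform sum for \<open>n - 1\<close>. It reappears as
    \<open>\<theta> * S\<close> in the sum for \<open>n\<close> and cancels in the difference,
    leaving the term \<open>j = 0\<close>.\<close>
  define S where "S = (\<Sum>j<m. \<theta> ^ j * ?\<psi> (m - 1 - j))"
  have "(\<Sum>j<Suc m. \<theta> ^ j * ?\<psi> (Suc m - 1 - j)) = ?\<psi> m + \<theta> * S"
    unfolding S_def by (subst sum.lessThan_Suc_shift) (simp add: sum_distrib_left mult.assoc)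
  \<comment> \<open>Since \<open>k < m\<close>, both lengths have a correction term, which supply
    the two terms with \<open>t\<close> in the recurrence, and neither all-ones word is weighted by
    \<open>t\<close>.\<close>
  then have Suc_m: "word_pgf q k t (Suc m) \<theta> =
      (1 - \<theta>) * (?\<psi> m + \<theta> * S + \<theta> ^ k * (t - 1) * ?\<psi> (m - k)) + \<theta> ^ Suc m"
    using m by (subst word_pgf_first_failure[OF assms(1)]) simp
  have m_eq: "word_pgf q k t m \<theta> = (1 - \<theta>) * (S + \<theta> ^ k * (t - 1) * ?\<psi> (m - k - 1)) + \<theta> ^ m"
    using m unfolding S_def by (subst word_pgf_first_failure[OF assms(1)]) (simp add: diff_right_commute)
  have diffs: "Suc m - k - 1 = m - k" "Suc m - k - 2 = m - k - 1" using m by auto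
  show ?thesis
    unfolding n diffs diff_Suc_1 Suc_m m_eq by (simp add: algebra_simps)
qed

theorem proposition3p1:
  fixes q \<theta> :: real and k :: nat
    and M :: "'a measure" and X :: "nat \<Rightarrow> 'a \<Rightarrow> nat"
    and N :: "'b measure" and Y :: "nat \<Rightarrow> 'b \<Rightarrow> nat"
  assumes "0 < q" "q \<le> 1" "0 \<le> \<theta>" "\<theta> \<le> 1" "k \<ge> 1"
    and "q_sequence M X \<theta> q"
    and "q_sequence N Y (\<theta> * q) q"
  shows "(\<forall>n t. n > k + 1 \<longrightarrow>
            runs_pgf M X t n k =
              \<theta> * runs_pgf M X t (n - 1) k
              + (1 - \<theta>) * (runs_pgf N Y t (n - 1) k
                  + \<theta> ^ k * (t - 1) * runs_pgf N Y t (n - k - 1) k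
                  + \<theta> ^ (k + 1) * (1 - t) * runs_pgf N Y t (n - k - 2) k))
       \<and> (\<forall>n t. n < k \<longrightarrow> runs_pgf M X t n k = 1)
       \<and> (\<forall>t. runs_pgf M X t k k = 1 + \<theta> ^ k * (t - 1))
       \<and> (\<forall>t. runs_pgf M X t (k + 1) k =
              1 - \<theta> ^ k * (1 - \<theta>) * (1 + q ^ k) + \<theta> ^ k * (1 - \<theta>) * (1 + q ^ k) * t)"
proof (intro conjI allI impI)
  note pgf = runs_pgf_eq_word_pgf[OF assms(6)] runs_pgf_eq_word_pgf[OF assms(7)]
  fix n t
  show "n > k + 1 \<Longrightarrow> runs_pgf M X t n k =
      \<theta> * runs_pgf M X t (n - 1) k
      + (1 - \<theta>) * (runs_pgf N Y t (n - 1) k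
          + \<theta> ^ k * (t - 1) * runs_pgf N Y t (n - k - 1) k
          + \<theta> ^ (k + 1) * (1 - t) * runs_pgf N Y t (n - k - 2) k)"
    unfolding pgf using \<open>k \<ge> 1\<close> by (rule word_pgf_recurrence)
  show "n < k \<Longrightarrow> runs_pgf M X t n k = 1"
    unfolding pgf using \<open>k \<ge> 1\<close> by (rule word_pgf_less)
  show "runs_pgf M X t k k = 1 + \<theta> ^ k * (t - 1)"
    unfolding pgf using \<open>k \<ge> 1\<close> by (rule word_pgf_eq)
  show "runs_pgf M X t (k + 1) k =
      1 - \<theta> ^ k * (1 - \<theta>) * (1 + q ^ k) + \<theta> ^ k * (1 - \<theta>) * (1 + q ^ k) * t"
    using word_pgf_Suc[OF \<open>k \<ge> 1\<close>, of q t \<theta>] unfolding pgf by (simp add: algebra_simps)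
qed

end
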